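(* Let $k\ge0$. Let $B_k(x)=\sum_{n\ge1}b_{n,k}x^n$, where $b_{n,k}$ is the total number, over all Schroeder trees with $n$ leaves, of vertices that are balanced and of rank $k$. Let $B_k^*(x)=\sum_{n\ge1}b^*_{n,k}x^n$, where $b^*_{n,k}$ is the number of Schroeder trees with $n$ leaves whose root is balanced and of rank $k$. Then $$B_k(x)=B_k^*(x)\,\frac{3-x+\sqrt{1-6x+x^2}}{4\sqrt{1-6x+x^2}}.$$
   Context: A Schroeder tree is a finite rooted plane tree (the children of each vertex are linearly ordered) in which every non-leaf vertex has at least two children. A leaf is a vertex with no children; the one-vertex tree is a Schroeder tree with one leaf. Trees are counted up to isomorphism of rooted plane trees. A vertex has rank $k$ if the shortest path from it to a leaf travelling strictly through descendants has length $k$ (number of edges); a leaf has rank $0$. A vertex is balanced if its shortest and longest descending paths to a leaf have the same length. Thus a vertex is balanced of rank $k$ if and only if all descending paths from it to a leaf have length $k$. $\sqrt{1-6x+x^2}$ denotes the formal power series square root with constant term $1$. *)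

theory Defs
  imports Complex_Main "HOL-Computational_Algebra.Formal_Power_Series"
begin

unbundle fps_syntax

text \<open>
  A finite rooted plane tree is given by the ordered list of the subtrees at the children of the
  root, so isomorphism of rooted plane trees is equality of this datatype.
\<close>
datatype plane_tree = Node (children: "plane_tree list")

text \<open>
  A vertex is addressed by the list of child indices leading to it from the root. The descendants
  of \<open>p\<close> are the vertices \<open>p @ r\<close>, and the descending path from \<open>p\<close> to \<open>p @ r\<close> has \<open>length r\<close> edges.
\<close>
fun is_vertex :: "plane_tree \<Rightarrow> nat list \<Rightarrow> bool" where
  "is_vertex t [] \<longleftrightarrow> True"
| "is_vertex t (i # p) \<longleftrightarrow> i < length (children t) \<and> is_vertex (children t ! i) p"

text \<open>Only meaningful if \<open>is_vertex t p\<close>.\<close>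
fun subtree :: "plane_tree \<Rightarrow> nat list \<Rightarrow> plane_tree" where
  "subtree t [] = t"
| "subtree t (i # p) = subtree (children t ! i) p"

definition vertices :: "plane_tree \<Rightarrow> nat list set" where
  "vertices t = {p. is_vertex t p}"

definition num_children :: "plane_tree \<Rightarrow> nat list \<Rightarrow> nat" where
  "num_children t p = length (children (subtree t p))"

definition leaves :: "plane_tree \<Rightarrow> nat list set" where
  "leaves t = {p \<in> vertices t. num_children t p = 0}"

definition schroeder :: "plane_tree \<Rightarrow> bool" where
  "schroeder t \<longleftrightarrow> (\<forall>p \<in> vertices t. p \<notin> leaves t \<longrightarrow> num_children t p \<ge> 2)"

definition schroeder_trees :: "nat \<Rightarrow> plane_tree set" where
  "schroeder_trees n = {t. schroeder t \<and> card (leaves t) = n}"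

definition leaf_path_lengths :: "plane_tree \<Rightarrow> nat list \<Rightarrow> nat set" where
  "leaf_path_lengths t p = {length r | r. p @ r \<in> leaves t}"

text \<open>
  The sets in \<open>Min\<close>, \<open>Max\<close>, \<open>card\<close> and \<open>sum\<close> below are finite, and the first two are nonempty:
  see the lemmas at the end.
\<close>
definition vertex_rank :: "plane_tree \<Rightarrow> nat list \<Rightarrow> nat" where
  "vertex_rank t p = Min (leaf_path_lengths t p)"

definition balanced :: "plane_tree \<Rightarrow> nat list \<Rightarrow> bool" where
  "balanced t p \<longleftrightarrow> Min (leaf_path_lengths t p) = Max (leaf_path_lengths t p)"

definition b :: "nat \<Rightarrow> nat \<Rightarrow> nat" where
  "b n k = (\<Sum>t \<in> schroeder_trees n. card {p \<in> vertices t. balanced t p \<and> vertex_rank t p = k})"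

definition b_star :: "nat \<Rightarrow> nat \<Rightarrow> nat" where
  "b_star n k = card {t \<in> schroeder_trees n. balanced t [] \<and> vertex_rank t [] = k}"

definition B :: "nat \<Rightarrow> real fps" where
  "B k = Abs_fps (\<lambda>n. if n \<ge> 1 then of_nat (b n k) else 0)"

definition B_star :: "nat \<Rightarrow> real fps" where
  "B_star k = Abs_fps (\<lambda>n. if n \<ge> 1 then of_nat (b_star n k) else 0)"

definition schroeder_sqrt :: "real fps" where
  "schroeder_sqrt = fps_radical root 2 (1 - 6 * fps_X + fps_X ^ 2)"


lemma schroeder_sqrt_square: "schroeder_sqrt ^ 2 = 1 - 6 * fps_X + fps_X ^ 2"
proof -
  let ?a = "1 - 6 * fps_X + fps_X ^ 2 :: real fps"
  have a0: "?a $ 0 = 1" by (simp add: fps_nth_power_0)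
  have "fps_radical root (Suc 1) ?a ^ Suc 1 = ?a"
    using a0 power_radical[where r=root and k=1 and a="?a"] by simp
  thus ?thesis by (simp add: schroeder_sqrt_def numeral_2_eq_2)
qed

lemma schroeder_sqrt_nth_0: "schroeder_sqrt $ 0 = 1"
  by (simp add: schroeder_sqrt_def fps_nth_power_0)

lemma vertices_rec:
  "vertices t = insert [] (\<Union>i<length (children t). (#) i ` vertices (children t ! i))"
proof (intro set_eqI)
  show "p \<in> vertices t \<longleftrightarrow>
      p \<in> insert [] (\<Union>i<length (children t). (#) i ` vertices (children t ! i))" for p
    by (cases p) (auto simp: vertices_def)
qed

lemma finite_vertices: "finite (vertices t)"
proof (induction t)
  case (Node ts)
  thus ?case by (subst vertices_rec) auto
qed

lemma finite_leaves: "finite (leaves t)"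
  using finite_vertices by (simp add: leaves_def)

lemma leaves_rec:
  "leaves t = (if children t = [] then {[]} else
     (\<Union>i<length (children t). (#) i ` leaves (children t ! i)))"
proof (intro set_eqI)
  show "p \<in> leaves t \<longleftrightarrow> p \<in> (if children t = [] then {[]} else
     (\<Union>i<length (children t). (#) i ` leaves (children t ! i)))" for p
    by (cases p) (auto simp: leaves_def vertices_def num_children_def)
qed

lemma leaves_nonempty: "leaves t \<noteq> {}"
proof (induction t)
  case (Node ts)
  show ?case
  proof (cases "ts = []")
    case False
    hence "leaves (ts ! 0) \<noteq> {}" using Node by simp
    thus ?thesis using False by (subst leaves_rec) auto
  qed (subst leaves_rec, simp)
qed

lemma leaf_below: "is_vertex t p \<Longrightarrow> \<exists>r. p @ r \<in> leaves t"
proof (induction t p rule: is_vertex.induct)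
  case (1 t)
  thus ?case using leaves_nonempty by auto
next
  case (2 t i p)
  then obtain r where "p @ r \<in> leaves (children t ! i)" by auto
  hence "(i # p) @ r \<in> leaves t" using 2 by (subst leaves_rec) auto
  thus ?case by blast
qed

lemma leaf_path_lengths_nonempty: "p \<in> vertices t \<Longrightarrow> leaf_path_lengths t p \<noteq> {}"
  using leaf_below by (auto simp: leaf_path_lengths_def vertices_def)

lemma finite_leaf_path_lengths: "finite (leaf_path_lengths t p)"
proof (rule finite_subset)
  show "leaf_path_lengths t p \<subseteq> (\<lambda>q. length q - length p) ` leaves t"
    by (force simp: leaf_path_lengths_def)
qed (simp add: finite_leaves)

lemma card_leaves_Node:
  assumes "children t \<noteq> []"
  shows "card (leaves t) = (\<Sum>i<length (children t). card (leaves (children t ! i)))"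
proof -
  have "leaves t = (\<Union>i<length (children t). (#) i ` leaves (children t ! i))"
    using assms by (subst leaves_rec) simp
  hence "card (leaves t) = (\<Sum>i<length (children t). card ((#) i ` leaves (children t ! i)))"
    by (auto intro!: card_UN_disjoint simp: finite_leaves)
  thus ?thesis by (simp add: card_image)
qed

lemma schroeder_child:
  assumes "schroeder t" "i < length (children t)"
  shows "schroeder (children t ! i)"
  unfolding schroeder_def
proof (intro ballI impI)
  fix p assume p: "p \<in> vertices (children t ! i)" "p \<notin> leaves (children t ! i)"
  hence "i # p \<in> vertices t" "i # p \<notin> leaves t"
    using assms(2) by (auto simp: vertices_def leaves_def num_children_def)
  thus "2 \<le> num_children (children t ! i) p"
    using assms(1) by (auto simp: schroeder_def num_children_def)
qed

lemma card_leaves_pos: "card (leaves t) > 0"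
  using finite_leaves leaves_nonempty by (simp add: card_gt_0_iff)

lemma finite_schroeder_trees: "finite (schroeder_trees n)"
proof (induction n rule: less_induct)
  case (less n)
  let ?S = "\<Union>m<n. schroeder_trees m"
  have "schroeder_trees n \<subseteq>
      insert (Node []) (Node ` {ts. set ts \<subseteq> ?S \<and> length ts \<le> n})"
  proof
    fix t assume "t \<in> schroeder_trees n"
    hence t: "schroeder t" "card (leaves t) = n" by (auto simp: schroeder_trees_def)
    show "t \<in> insert (Node []) (Node ` {ts. set ts \<subseteq> ?S \<and> length ts \<le> n})"
    proof (cases "children t = []")
      case True
      thus ?thesis by (cases t) auto
    next
      case False
      let ?c = "\<lambda>i. card (leaves (children t ! i))"
      let ?l = "length (children t)"
      have "[] \<in> vertices t" "[] \<notin> leaves t"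
        using False by (auto simp: vertices_def leaves_def num_children_def)
      hence l2: "?l \<ge> 2" using t(1) by (force simp: schroeder_def num_children_def)
      have s: "(\<Sum>i<?l. ?c i) = n" using card_leaves_Node[OF False] t by simp
      have pos: "?c i \<ge> 1" for i using card_leaves_pos by (simp add: Suc_le_eq)
      have "(\<Sum>i<?l. 1) \<le> (\<Sum>i<?l. ?c i)" by (rule sum_mono) (rule pos)
      hence len: "?l \<le> n" using s by simp
      have "children t ! i \<in> ?S" if i: "i < ?l" for i
      proof -
        have "(\<Sum>j\<in>{..<?l} - {i}. 1) \<le> (\<Sum>j\<in>{..<?l} - {i}. ?c j)"
          by (rule sum_mono) (rule pos)
        moreover have "(\<Sum>j<?l. ?c j) = ?c i + (\<Sum>j\<in>{..<?l} - {i}. ?c j)"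
          using i by (subst sum.remove[of _ i]) auto
        ultimately have "?c i < n" using s l2 i by simp
        thus ?thesis using schroeder_child[OF t(1) i] by (auto simp: schroeder_trees_def)
      qed
      hence "set (children t) \<subseteq> ?S" by (metis in_set_conv_nth subsetI)
      thus ?thesis using len
        by (metis (mono_tags, lifting) imageI insertI2 mem_Collect_eq plane_tree.collapse)
    qed
  qed
  moreover have "finite ?S" using less by blast
  ultimately show ?case by (auto intro: finite_subset simp: finite_lists_length_le)
qed

end

theory Submission
  imports Defs
begin

text \<open>
  Let \<open>S\<close> count Schroeder trees by leaves and let \<open>F\<close> count finite sequences of Schroeder trees
  by total number of leaves, so \<open>F = 1 + S * F\<close>. Sending an inner vertex to its sequence of
  subtrees shows that \<open>S = X + (F - 1 - S)\<close>. Weighting a tree by its number of balanced vertices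
  of rank \<open>k\<close>, and a sequence by the sum of the weights of its members, gives series \<open>B\<close> and \<open>G\<close>
  with \<open>G = B * F + S * G\<close> and \<open>B = B\<^sub>* + (G - B)\<close>, where \<open>B\<^sub>*\<close> accounts for the roots. Hence
  \<open>B * (2 - 1 / (1 - S)\<^sup>2) = B\<^sub>*\<close>, while the equations for \<open>S\<close> and \<open>F\<close> give
  \<open>4 * S = 1 + X - sqrt (1 - 6 * X + X\<^sup>2)\<close>.
\<close>

subsection \<open>Weighted generating functions\<close>

text \<open>A sum over an infinite fibre of \<open>s\<close> is 0 by convention, so the rules for
  unions and products below assume finite fibres.\<close>

definition gf :: "'a set \<Rightarrow> ('a \<Rightarrow> nat) \<Rightarrow> ('a \<Rightarrow> real) \<Rightarrow> real fps" where
  "gf A s w = Abs_fps (\<lambda>n. \<Sum>a \<in> {a \<in> A. s a = n}. w a)"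

lemma gf_cong:
  assumes "\<And>a. a \<in> A \<Longrightarrow> s a = s' a" "\<And>a. a \<in> A \<Longrightarrow> w a = w' a"
  shows "gf A s w = gf A s' w'"
  unfolding gf_def using assms
  by (intro arg_cong[where f = Abs_fps] ext sum.cong) auto

lemma gf_add: "gf A s (\<lambda>a. v a + w a) = gf A s v + gf A s w"
  by (simp add: gf_def fps_eq_iff sum.distrib)

lemma gf_singleton: "gf {a} s w = fps_const (w a) * fps_X ^ s a"
proof (rule fps_ext)
  fix n
  have "{x \<in> {a}. s x = n} = (if s a = n then {a} else {})" by auto
  thus "gf {a} s w $ n = (fps_const (w a) * fps_X ^ s a) $ n"
    by (simp add: gf_def fps_X_power_nth)
qed

lemma gf_Un:
  assumes "A \<inter> C = {}" "\<And>n. finite {a \<in> A \<union> C. s a = n}"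
  shows "gf (A \<union> C) s w = gf A s w + gf C s w"
proof (rule fps_ext)
  fix n
  have "{a \<in> A \<union> C. s a = n} = {a \<in> A. s a = n} \<union> {a \<in> C. s a = n}" by auto
  moreover have "finite {a \<in> A. s a = n}" "finite {a \<in> C. s a = n}"
    by (rule finite_subset[OF _ assms(2)[of n]]; auto)+
  ultimately show "gf (A \<union> C) s w $ n = (gf A s w + gf C s w) $ n"
    using assms(1) by (auto simp: gf_def intro!: sum.union_disjoint)
qed

lemma gf_image:
  assumes "inj_on f A"
  shows "gf (f ` A) s w = gf A (s \<circ> f) (w \<circ> f)"
proof (rule fps_ext)
  fix n
  have "{a \<in> f ` A. s a = n} = f ` {a \<in> A. (s \<circ> f) a = n}" by auto
  moreover have "inj_on f {a \<in> A. (s \<circ> f) a = n}"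
    using assms by (rule inj_on_subset) auto
  ultimately show "gf (f ` A) s w $ n = gf A (s \<circ> f) (w \<circ> f) $ n"
    by (simp add: gf_def sum.reindex)
qed

text \<open>The fibre of the product over \<open>n\<close> is the disjoint union, over
  \<open>i\<close> up to \<open>n\<close>, of the products of the fibres over \<open>i\<close> and
  \<open>n - i\<close>; this is the Cauchy product.\<close>

lemma gf_Times:
  assumes "\<And>n. finite {a \<in> A. s a = n}" "\<And>n. finite {c \<in> C. u c = n}"
  shows "gf (A \<times> C) (\<lambda>(a, c). s a + u c) (\<lambda>(a, c). v a * w c) = gf A s v * gf C u w"
proof (rule fps_ext)
  fix n
  let ?P = "\<lambda>i. {a \<in> A. s a = i} \<times> {c \<in> C. u c = n - i}"
  have eq: "{p \<in> A \<times> C. (case p of (a, c) \<Rightarrow> s a + u c) = n} = (\<Union>i\<in>{0..n}. ?P i)"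
    by auto
  have "gf (A \<times> C) (\<lambda>(a, c). s a + u c) (\<lambda>(a, c). v a * w c) $ n
      = (\<Sum>i=0..n. \<Sum>(a, c)\<in>?P i. v a * w c)"
    unfolding gf_def fps_nth_Abs_fps eq
    by (rule sum.UNION_disjoint) (auto simp: assms)
  also have "\<dots> = (gf A s v * gf C u w) $ n"
    by (simp add: gf_def fps_mult_nth sum_product sum.cartesian_product)
  finally show "gf (A \<times> C) (\<lambda>(a, c). s a + u c) (\<lambda>(a, c). v a * w c) $ n
      = (gf A s v * gf C u w) $ n" .
qed

subsection \<open>Schroeder trees and forests\<close>

abbreviation num_leaves :: "plane_tree \<Rightarrow> nat" where
  "num_leaves t \<equiv> card (leaves t)"

abbreviation forest_leaves :: "plane_tree list \<Rightarrow> nat" where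
  "forest_leaves ts \<equiv> sum_list (map num_leaves ts)"

definition forests :: "plane_tree list set" where
  "forests = lists (Collect schroeder)"

lemma num_leaves_leaf: "num_leaves (Node []) = 1"
  by (subst leaves_rec) simp

lemma num_leaves_Node: "ts \<noteq> [] \<Longrightarrow> num_leaves (Node ts) = forest_leaves ts"
  by (simp add: card_leaves_Node sum_list_sum_nth atLeast0LessThan)

text \<open>Vertices below the root inherit their condition from the subtrees; the root may be a
  leaf or have at least two children, so only length 1 is forbidden.\<close>

lemma schroeder_Node_iff:
  "schroeder (Node ts) \<longleftrightarrow> length ts \<noteq> 1 \<and> ts \<in> forests"
proof (intro iffI conjI)
  assume s: "schroeder (Node ts)"
  show "ts \<in> forests"
    using schroeder_child[OF s] by (auto simp: forests_def in_set_conv_nth)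
  show "length ts \<noteq> 1"
    using s unfolding schroeder_def leaves_def
    by (auto simp: vertices_def num_children_def dest!: spec[of _ "[]"])
next
  assume a: "length ts \<noteq> 1 \<and> ts \<in> forests"
  have c: "schroeder (ts ! i)" if "i < length ts" for i
    using a that by (auto simp: forests_def)
  show "schroeder (Node ts)"
    unfolding schroeder_def
  proof (intro ballI impI)
    fix p assume p: "p \<in> vertices (Node ts)" "p \<notin> leaves (Node ts)"
    show "2 \<le> num_children (Node ts) p"
    proof (cases p)
      case Nil
      hence "length ts \<noteq> 0" using p by (auto simp: leaves_def num_children_def)
      hence "2 \<le> length ts" using a by linarith
      thus ?thesis using Nil by (simp add: num_children_def)
    next
      case (Cons i q)
      hence i: "i < length ts" "q \<in> vertices (ts ! i)" "q \<notin> leaves (ts ! i)"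
        using p by (auto simp: vertices_def leaves_def num_children_def)
      hence "2 \<le> num_children (ts ! i) q" using c[OF i(1)] by (simp add: schroeder_def)
      thus ?thesis using Cons by (simp add: num_children_def)
    qed
  qed
qed

lemma schroeder_trees_0: "schroeder_trees 0 = {}"
  using card_leaves_pos by (auto simp: schroeder_trees_def)

lemma finite_schroeder: "finite {t \<in> Collect schroeder. num_leaves t = n}"
  using finite_schroeder_trees[of n] by (simp add: schroeder_trees_def)

text \<open>A forest of length one is a single tree, and a longer one is the child list of a
  Schroeder tree with equally many leaves, so finiteness carries over from trees.\<close>

lemma finite_forests: "finite {ts \<in> forests. forest_leaves ts = n}"
proof (rule finite_subset)
  let ?T = "schroeder_trees n"
  show "{ts \<in> forests. forest_leaves ts = n} \<subseteq> insert [] ((\<lambda>t. [t]) ` ?T \<union> children ` ?T)"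
  proof
    fix ts assume ts: "ts \<in> {ts \<in> forests. forest_leaves ts = n}"
    show "ts \<in> insert [] ((\<lambda>t. [t]) ` ?T \<union> children ` ?T)"
    proof (cases "length ts = 1")
      case True
      then obtain t where "ts = [t]" by (auto simp: length_Suc_conv)
      thus ?thesis using ts by (auto simp: forests_def schroeder_trees_def)
    next
      case False
      hence "ts \<noteq> [] \<Longrightarrow> Node ts \<in> ?T"
        using ts by (simp add: schroeder_trees_def schroeder_Node_iff num_leaves_Node)
      thus ?thesis by (metis UnI2 image_eqI insertCI plane_tree.sel)
    qed
  qed
qed (simp add: finite_schroeder_trees)

lemma forests_decomp:
  "forests = {[]} \<union> (\<lambda>(t, ts). t # ts) ` (Collect schroeder \<times> forests)"
proof (intro set_eqI)
  show "ts \<in> forests \<longleftrightarrow> ts \<in> {[]} \<union> (\<lambda>(t, ts). t # ts) ` (Collect schroeder \<times> forests)" for ts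
    by (cases ts) (auto simp: forests_def)
qed

lemma forests_split:
  "forests = {[]} \<union> ((\<lambda>t. [t]) ` Collect schroeder \<union> {ts \<in> forests. length ts \<ge> 2})"
proof (intro set_eqI)
  fix ts :: "plane_tree list"
  have "length ts = 0 \<or> length ts = 1 \<or> length ts \<ge> 2" by linarith
  thus "ts \<in> forests \<longleftrightarrow>
      ts \<in> {[]} \<union> ((\<lambda>t. [t]) ` Collect schroeder \<union> {ts \<in> forests. length ts \<ge> 2})"
    by (auto simp: forests_def length_Suc_conv)
qed

lemma schroeder_decomp:
  "Collect schroeder = {Node []} \<union> Node ` {ts \<in> forests. length ts \<ge> 2}"
proof (intro set_eqI)
  fix t
  obtain ts where t: "t = Node ts" by (cases t)
  have "length ts = 0 \<or> length ts = 1 \<or> length ts \<ge> 2" by linarith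
  thus "t \<in> Collect schroeder \<longleftrightarrow> t \<in> {Node []} \<union> Node ` {ts \<in> forests. length ts \<ge> 2}"
    unfolding t by (auto simp: schroeder_Node_iff forests_def)
qed

section \<open>Functional equations for trees and forests\<close>

abbreviation tree_gf :: "(plane_tree \<Rightarrow> real) \<Rightarrow> real fps" where
  "tree_gf \<equiv> gf (Collect schroeder) num_leaves"

abbreviation forest_gf :: "(plane_tree list \<Rightarrow> real) \<Rightarrow> real fps" where
  "forest_gf \<equiv> gf forests forest_leaves"

text \<open>Splits off the first tree. The right side stays a series over pairs because
  \<open>w (t # ts)\<close> need not factor.\<close>

lemma forest_gf_Cons:
  "forest_gf w = fps_const (w []) +
     gf (Collect schroeder \<times> forests) (\<lambda>(t, ts). num_leaves t + forest_leaves ts)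
       (\<lambda>(t, ts). w (t # ts))"
proof -
  let ?C = "\<lambda>(t, ts). t # ts :: plane_tree list"
  let ?I = "?C ` (Collect schroeder \<times> forests)"
  have "forest_gf w = gf ({[]} \<union> ?I) forest_leaves w"
    using forests_decomp by simp
  also have "\<dots> = gf {[]} forest_leaves w + gf ?I forest_leaves w"
    by (rule gf_Un, force) (simp only: finite_forests flip: forests_decomp)
  also have "gf {[]} forest_leaves w = fps_const (w [])"
    by (simp add: gf_singleton)
  also have "gf ?I forest_leaves w =
      gf (Collect schroeder \<times> forests) (forest_leaves \<circ> ?C) (w \<circ> ?C)"
    by (rule gf_image) (auto simp: inj_on_def)
  also have "\<dots> = gf (Collect schroeder \<times> forests)
      (\<lambda>(t, ts). num_leaves t + forest_leaves ts) (\<lambda>(t, ts). w (t # ts))"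
    by (rule gf_cong) auto
  finally show ?thesis .
qed

text \<open>Child lists of inner vertices are all forests except those of length 0 and 1, hence the
  two subtracted terms. \<open>Node [t]\<close> is not a Schroeder tree; its weight only cancels a
  term of the forest series.\<close>

lemma tree_gf_Node:
  "tree_gf w = fps_const (w (Node [])) * fps_X +
     (forest_gf (w \<circ> Node) - fps_const (w (Node [])) - tree_gf (\<lambda>t. w (Node [t])))"
proof -
  let ?L = "{ts \<in> forests. length ts \<ge> 2}"
  let ?N = "(\<lambda>t. [t]) ` Collect schroeder"
  let ?v = "w \<circ> Node"
  have fin: "finite {ts \<in> ?N \<union> ?L. forest_leaves ts = n}" for n
    by (rule finite_subset[OF _ finite_forests[of n]]) (auto simp: forests_def)
  have "tree_gf w = gf ({Node []} \<union> Node ` ?L) num_leaves w"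
    using schroeder_decomp by simp
  also have "\<dots> = gf {Node []} num_leaves w + gf (Node ` ?L) num_leaves w"
    by (rule gf_Un, force) (simp only: finite_schroeder flip: schroeder_decomp)
  also have "gf {Node []} num_leaves w = fps_const (w (Node [])) * fps_X"
    by (simp add: gf_singleton num_leaves_leaf)
  also have "gf (Node ` ?L) num_leaves w = gf ?L (num_leaves \<circ> Node) ?v"
    by (rule gf_image) (auto simp: inj_on_def)
  also have "\<dots> = gf ?L forest_leaves ?v"
    by (rule gf_cong) (auto intro!: num_leaves_Node)
  finally have 1: "tree_gf w = fps_const (w (Node [])) * fps_X + gf ?L forest_leaves ?v" .
  have "forest_gf ?v = gf ({[]} \<union> (?N \<union> ?L)) forest_leaves ?v"
    using forests_split by simp
  also have "\<dots> = gf {[]} forest_leaves ?v + gf (?N \<union> ?L) forest_leaves ?v"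
    by (rule gf_Un, force) (simp only: finite_forests flip: forests_split)
  also have "gf (?N \<union> ?L) forest_leaves ?v = gf ?N forest_leaves ?v + gf ?L forest_leaves ?v"
    using fin by (intro gf_Un) auto
  also have "gf ?N forest_leaves ?v = tree_gf (\<lambda>t. w (Node [t]))"
    by (subst gf_image) (auto simp: inj_on_def intro!: gf_cong)
  also have "gf {[]} forest_leaves ?v = fps_const (w (Node []))"
    by (simp add: gf_singleton)
  finally show ?thesis using 1 by (simp add: o_def)
qed

lemma forest_gf_one: "forest_gf (\<lambda>_. 1) = 1 + tree_gf (\<lambda>_. 1) * forest_gf (\<lambda>_. 1)"
  using forest_gf_Cons[of "\<lambda>_. 1"]
    gf_Times[OF finite_schroeder finite_forests, of "\<lambda>_. 1" "\<lambda>_. 1"]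
  by simp

text \<open>An additive weight behaves like a derivation: it falls either on the first tree or on
  the remaining forest.\<close>

lemma forest_gf_sum:
  fixes w :: "plane_tree \<Rightarrow> real"
  defines "W \<equiv> \<lambda>ts. sum_list (map w ts)"
  shows "forest_gf W = tree_gf w * forest_gf (\<lambda>_. 1) + tree_gf (\<lambda>_. 1) * forest_gf W"
proof -
  let ?g = "gf (Collect schroeder \<times> forests) (\<lambda>(t, ts). num_leaves t + forest_leaves ts)"
  have "forest_gf W = ?g (\<lambda>(t, ts). W (t # ts))"
    by (subst forest_gf_Cons) (simp add: W_def)
  \<comment> \<open>The factors 1 put each summand into the product form that
    \<open>gf_Times\<close> requires.\<close>
  also have "\<dots> = ?g (\<lambda>p. (case p of (t, ts) \<Rightarrow> w t * 1) + (case p of (t, ts) \<Rightarrow> 1 * W ts))"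
    by (rule gf_cong) (auto simp: W_def)
  also have "\<dots> = tree_gf w * forest_gf (\<lambda>_. 1) + tree_gf (\<lambda>_. 1) * forest_gf W"
    unfolding gf_add by (simp only: gf_Times[OF finite_schroeder finite_forests])
  finally show ?thesis .
qed

lemma tree_gf_one:
  "2 * tree_gf (\<lambda>_. 1) = fps_X + forest_gf (\<lambda>_. 1) - 1"
  using tree_gf_Node[of "\<lambda>_. 1"] by (simp add: o_def)

lemma schroeder_sqrt_eq: "schroeder_sqrt = 1 + fps_X - 4 * tree_gf (\<lambda>_. 1)"
proof -
  define S where "S = tree_gf (\<lambda>_. 1)"
  define F where "F = forest_gf (\<lambda>_. 1)"
  have F: "F = 2 * S - fps_X + 1" using tree_gf_one by (simp add: S_def F_def)
  have "F = 1 + S * F" using forest_gf_one by (simp add: S_def F_def)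
  \<comment> \<open>Eliminating \<open>F\<close> leaves a quadratic equation for \<open>S\<close>;
    completing the square gives the radicand.\<close>
  hence S: "2 * S ^ 2 = (1 + fps_X) * S - fps_X"
    unfolding F by (simp add: algebra_simps power2_eq_square)
  have "(1 + fps_X - 4 * S) ^ 2 = (1 + fps_X) ^ 2 - 8 * (1 + fps_X) * S + 8 * (2 * S ^ 2)"
    by (simp add: algebra_simps power2_eq_square)
  also have "\<dots> = schroeder_sqrt ^ 2"
    unfolding S schroeder_sqrt_square by (simp add: algebra_simps power2_eq_square)
  finally have "schroeder_sqrt = 1 + fps_X - 4 * S \<or> schroeder_sqrt = - (1 + fps_X - 4 * S)"
    by (metis power2_eq_iff)
  \<comment> \<open>No tree has 0 leaves. So the second candidate has constant coefficient -1,
    whereas the square root has 1.\<close>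
  moreover have "S $ 0 = 0"
    using schroeder_trees_0 by (simp add: S_def gf_def schroeder_trees_def del: Collect_empty_eq)
  hence "(- (1 + fps_X - 4 * S)) $ 0 = - 1"
    by (simp add: numeral_fps_const)
  hence "schroeder_sqrt \<noteq> - (1 + fps_X - 4 * S)"
    using schroeder_sqrt_nth_0 by (metis one_neq_neg_one)
  ultimately show ?thesis by (simp add: S_def)
qed

subsection \<open>Balanced vertices\<close>

definition balanced_of_rank :: "nat \<Rightarrow> plane_tree \<Rightarrow> nat list set" where
  "balanced_of_rank k t = {p \<in> vertices t. balanced t p \<and> vertex_rank t p = k}"

text \<open>The leaves below \<open>i # p\<close> and those below \<open>p\<close> in the child have
  the same continuations, so rank and balance depend on the subtree alone.\<close>

lemma leaf_path_lengths_Cons: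
  assumes "i < length (children t)"
  shows "leaf_path_lengths t (i # p) = leaf_path_lengths (children t ! i) p"
  using assms by (auto simp: leaf_path_lengths_def leaves_def vertices_def num_children_def)

lemma balanced_of_rank_rec:
  "balanced_of_rank k t =
     (if [] \<in> balanced_of_rank k t then {[]} else {}) \<union>
     (\<Union>i<length (children t). (#) i ` balanced_of_rank k (children t ! i))"
proof (intro set_eqI)
  fix p
  show "p \<in> balanced_of_rank k t \<longleftrightarrow> p \<in> (if [] \<in> balanced_of_rank k t then {[]} else {}) \<union>
     (\<Union>i<length (children t). (#) i ` balanced_of_rank k (children t ! i))"
  proof (cases p)
    case (Cons i q)
    have "i # q \<in> balanced_of_rank k t \<longleftrightarrow>
        i < length (children t) \<and> q \<in> balanced_of_rank k (children t ! i)"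
      by (auto simp: balanced_of_rank_def balanced_def vertex_rank_def vertices_def
          leaf_path_lengths_Cons)
    thus ?thesis using Cons by auto
  qed auto
qed

text \<open>Splits the weight of a tree into a root contribution and the additive weight of its
  child list, the form to which \<open>tree_gf_Node\<close> and \<open>forest_gf_sum\<close>
  apply.\<close>

lemma card_balanced_of_rank:
  "card (balanced_of_rank k t) = of_bool ([] \<in> balanced_of_rank k t) +
     sum_list (map (\<lambda>t. card (balanced_of_rank k t)) (children t))"
proof -
  have fin: "finite (balanced_of_rank k t)" for t
    using finite_vertices by (simp add: balanced_of_rank_def)
  let ?U = "\<Union>i<length (children t). (#) i ` balanced_of_rank k (children t ! i)"
  have "card (balanced_of_rank k t) =
      card ((if [] \<in> balanced_of_rank k t then {[]} else {}) \<union> ?U)"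
    using balanced_of_rank_rec by simp
  also have "\<dots> = of_bool ([] \<in> balanced_of_rank k t) + card ?U"
    by (subst card_Un_disjoint) (auto simp: fin)
  also have "card ?U = (\<Sum>i<length (children t). card ((#) i ` balanced_of_rank k (children t ! i)))"
    by (rule card_UN_disjoint) (auto simp: fin)
  also have "\<dots> = sum_list (map (\<lambda>t. card (balanced_of_rank k t)) (children t))"
    by (simp add: card_image sum_list_sum_nth atLeast0LessThan)
  finally show ?thesis .
qed

lemma B_eq_gf: "B k = tree_gf (\<lambda>t. card (balanced_of_rank k t))"
proof (rule fps_ext)
  show "B k $ n = tree_gf (\<lambda>t. card (balanced_of_rank k t)) $ n" for n
    \<comment> \<open>Coefficient 0 is set to 0 in \<open>B\<close>; it vanishes in
      \<open>tree_gf\<close> because every tree has a leaf.\<close>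
    using schroeder_trees_0
    by (cases "n = 0") (simp_all add: B_def b_def gf_def balanced_of_rank_def schroeder_trees_def
        del: Collect_empty_eq)
qed

lemma B_star_eq_gf: "B_star k = tree_gf (\<lambda>t. of_bool ([] \<in> balanced_of_rank k t))"
proof (rule fps_ext)
  fix n
  let ?T = "schroeder_trees n"
  have "b_star n k = card {t \<in> ?T. [] \<in> balanced_of_rank k t}"
    by (simp add: b_star_def balanced_of_rank_def vertices_def)
  also have "real \<dots> = (\<Sum>t\<in>?T. of_bool ([] \<in> balanced_of_rank k t))"
    by (simp add: finite_schroeder_trees Int_def)
  finally show "B_star k $ n = tree_gf (\<lambda>t. of_bool ([] \<in> balanced_of_rank k t)) $ n"
    using schroeder_trees_0
    by (cases "n = 0") (simp_all add: B_star_def gf_def schroeder_trees_def del: Collect_empty_eq)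
qed

section \<open>The linear equation for \<open>B\<close> and its solution\<close>

lemma B_eq:
  defines "F \<equiv> forest_gf (\<lambda>_. 1)"
  shows "2 * B k = B_star k + B k * F ^ 2"
proof -
  define S where "S = tree_gf (\<lambda>_. 1)"
  define w where "w = (\<lambda>t. real (card (balanced_of_rank k t)))"
  define G where "G = forest_gf (\<lambda>ts. sum_list (map w ts))"
  define v where "v = (\<lambda>t. sum_list (map w (children t)))"
  have of_nat_sum: "real (sum_list (map f ts)) = (\<Sum>t\<leftarrow>ts. real (f t))"
    for f :: "plane_tree \<Rightarrow> nat" and ts
    by (induction ts) auto
  have w: "w t = of_bool ([] \<in> balanced_of_rank k t) + v t" for t
    unfolding w_def v_def
    by (subst card_balanced_of_rank) (simp add: of_nat_sum)
  have B: "B k = tree_gf w" by (simp add: B_eq_gf w_def)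
  also have "\<dots> = B_star k + tree_gf v"
    unfolding B_star_eq_gf gf_add[symmetric] using w by (intro gf_cong) auto
  \<comment> \<open>\<open>v\<close> vanishes on \<open>Node []\<close> and equals
    \<open>w t\<close> on \<open>Node [t]\<close>, so the correction term is
    \<open>B k\<close>.\<close>
  also have "tree_gf v = G - B k"
    by (subst tree_gf_Node) (simp add: v_def G_def B o_def)
  finally have 1: "2 * B k = B_star k + G" by simp
  have G: "G = B k * F + S * G"
    unfolding G_def B F_def S_def by (rule forest_gf_sum)
  have F: "F = 1 + S * F"
    unfolding F_def S_def by (rule forest_gf_one)
  \<comment> \<open>\<open>F\<close> is inverse to \<open>1 - S\<close>, so the linear equation for
    \<open>G\<close> solves to \<open>G = B k * F ^ 2\<close> without division.\<close>
  have "F - S * F = 1" using F by (metis add_diff_cancel_right')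
  hence "G = G * (F - S * F)" by simp
  also have "\<dots> = (G - S * G) * F" by (simp add: algebra_simps)
  also have "G - S * G = B k * F" using G by (simp add: algebra_simps)
  finally show ?thesis using 1 by (simp add: power2_eq_square mult.assoc)
qed

theorem theorem4p2:
  fixes k :: nat
  shows "B k = B_star k * ((3 - fps_X + schroeder_sqrt) / (4 * schroeder_sqrt))"
proof -
  define S where "S = tree_gf (\<lambda>_. 1)"
  define F where "F = forest_gf (\<lambda>_. 1)"
  \<comment> \<open>\<open>u\<close> is the inverse of \<open>F\<close>; the square root and
    \<open>F\<close> are both affine in \<open>u\<close>, and \<open>3 - fps_X + ?R\<close> is
    \<open>4 * u\<close>.\<close>
  define u where "u = 1 - S"
  let ?R = schroeder_sqrt
  have Fu: "F * u = 1"
    using forest_gf_one by (simp add: F_def S_def u_def algebra_simps)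
  have R: "?R = 4 * u - 3 + fps_X"
    by (simp add: schroeder_sqrt_eq u_def S_def)
  have F: "F = 3 - fps_X - 2 * u"
    using tree_gf_one by (simp add: F_def S_def u_def algebra_simps)
  have uR: "u * ?R = 2 * u ^ 2 - 1"
  proof -
    have "(3 - fps_X - 2 * u) * u = 1" using Fu F by simp
    thus ?thesis unfolding R by (simp add: algebra_simps power2_eq_square)
  qed
  \<comment> \<open>The factor \<open>u ^ 2\<close> clears \<open>F ^ 2\<close> from
    \<open>B_eq\<close>: since \<open>F * u = 1\<close>, the remaining terms in \<open>B k\<close>
    cancel.\<close>
  have "u * (B k * ?R) = (2 * B k) * u ^ 2 - B k"
    using uR by (metis (no_types, lifting) mult.assoc mult.commute mult.left_commute mult_1_right
        right_diff_distrib)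
  also have "\<dots> = B_star k * u ^ 2 + B k * (F * u) ^ 2 - B k"
    unfolding B_eq by (simp add: F_def algebra_simps power_mult_distrib)
  also have "\<dots> = u * (B_star k * u)" using Fu by (simp add: power2_eq_square)
  finally have "B k * ?R = B_star k * u" using Fu by auto
  moreover have "4 * u = 3 - fps_X + ?R" unfolding R by simp
  ultimately have *: "B k * (4 * ?R) = B_star k * (3 - fps_X + ?R)"
    by (metis mult.left_commute)
  \<comment> \<open>The constant coefficient is 4, so dividing by this series is multiplying by its
    inverse.\<close>
  have unit: "(4 * ?R) $ 0 \<noteq> 0"
    by (simp add: schroeder_sqrt_nth_0 numeral_fps_const)
  have "B k = B k * (4 * ?R) * inverse (4 * ?R)"
    using inverse_mult_eq_1'[OF unit] by (simp only: mult.assoc mult_1_right)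
  thus ?thesis
    unfolding * fps_divide_unit[OF unit] by (simp only: mult.assoc)
qed

end
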